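(* Let $\mathcal{H}$ be an infinite dimensional complex Hilbert space, let $A,B\in B(\mathcal{H})$ be Drazin invertible with Drazin inverses $A_d,B_d$, let $X,Y\in B(\mathcal{H})$ and let $m,n\ge1$ be integers. If $(A_d^*,A)$ is left-$(X,m)$-invertible, $(B_d^*,B)$ is left-$(Y,n)$-invertible, and $$[X,Y]=[A,B]=[A^*,Y]=[B^*,X]=0,$$ then $AB$ and $A+B$ are $(XY,m+n-1)$-selfadjoint.
   Context: $B(\mathcal{H})$ is the algebra of bounded linear operators on $\mathcal{H}$, and $[S,T]=ST-TS$. For $S,T,Z\in B(\mathcal{H})$ and an integer $m\ge 1$ put $$\triangle_{S,T}^m(Z)=\sum_{j=0}^m(-1)^j\binom{m}{j}S^{m-j}ZT^{m-j},\qquad \delta_{S,T}^m(Z)=\sum_{j=0}^m(-1)^j\binom{m}{j}S^{m-j}ZT^{j}.$$ $(S,T)$ is left-$(Z,m)$-invertible if $\triangle_{S,T}^m(Z)=0$; $T$ is $(Z,m)$-selfadjoint if $\delta_{T^*,T}^m(Z)=0$. $A$ is Drazin invertible, with Drazin inverse $A_d\in B(\mathcal{H})$, if $A_dA=AA_d$, $A_d^2A=A_d$ and $A^{p+1}A_d=A^p$ for some integer $p\ge1$. $A_d^*$ denotes $(A_d)^*$. *)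

theory Defs
  imports Complex_Main
begin

section \<open>Complex Hilbert spaces\<close>

text \<open>The inner product is linear in its first argument. Positive definiteness of the inner
  product is contained in the axiom that it induces the norm; completeness comes from the
  superclass.\<close>

class chilbert_space = banach +
  fixes scaleC :: "complex \<Rightarrow> 'a \<Rightarrow> 'a" (infixr \<open>*\<^sub>C\<close> 75)
    and cinner :: "'a \<Rightarrow> 'a \<Rightarrow> complex"
  assumes scaleC_add_right: "c *\<^sub>C (x + y) = c *\<^sub>C x + c *\<^sub>C y"
    and scaleC_add_left: "(c + d) *\<^sub>C x = c *\<^sub>C x + d *\<^sub>C x"
    and scaleC_scaleC: "c *\<^sub>C (d *\<^sub>C x) = (c * d) *\<^sub>C x"
    and scaleC_of_real: "complex_of_real r *\<^sub>C x = r *\<^sub>R x"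
    and cinner_commute: "cinner x y = cnj (cinner y x)"
    and cinner_add_left: "cinner (x + y) z = cinner x z + cinner y z"
    and cinner_scaleC_left: "cinner (c *\<^sub>C x) y = c * cinner x y"
    and cinner_self: "cinner x x = complex_of_real ((norm x)\<^sup>2)"

lemma scaleC_one: "1 *\<^sub>C x = (x::'a::chilbert_space)"
  using scaleC_of_real[of 1 x] by simp

lemma module_scaleC: "module (scaleC :: complex \<Rightarrow> 'a::chilbert_space \<Rightarrow> 'a)"
  by standard (simp_all add: scaleC_add_right scaleC_add_left scaleC_scaleC scaleC_one)

definition cspan :: "'a::chilbert_space set \<Rightarrow> 'a set"
  where "cspan = module.span scaleC"

definition infinite_dimensional :: "'a::chilbert_space itself \<Rightarrow> bool"
  where "infinite_dimensional _ \<longleftrightarrow> \<not> (\<exists>S::'a set. finite S \<and> cspan S = UNIV)"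

lemma cinner_add_right: "cinner x (y + z) = cinner x y + cinner x (z::'a::chilbert_space)"
  by (metis cinner_commute cinner_add_left complex_cnj_add)

lemma cinner_scaleC_right: "cinner x (c *\<^sub>C y) = cnj c * cinner x (y::'a::chilbert_space)"
  by (metis cinner_commute cinner_scaleC_left complex_cnj_mult)

lemma cinner_scaleR_left: "cinner (r *\<^sub>R x) y = of_real r * cinner x (y::'a::chilbert_space)"
  by (metis cinner_scaleC_left scaleC_of_real)

lemma cinner_scaleR_right: "cinner x (r *\<^sub>R y) = of_real r * cinner x (y::'a::chilbert_space)"
  by (metis cinner_scaleC_right scaleC_of_real complex_cnj_complex_of_real)

lemma cinner_minus_left: "cinner (- x) y = - cinner x (y::'a::chilbert_space)"
  using cinner_scaleR_left[of "-1" x y] by simp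

lemma cinner_minus_right: "cinner x (- y) = - cinner x (y::'a::chilbert_space)"
  using cinner_scaleR_right[of x "-1" y] by simp

lemma cinner_diff_left: "cinner (x - y) z = cinner x z - cinner y (z::'a::chilbert_space)"
  using cinner_add_left[of x "-y" z] by (simp add: cinner_minus_left)

lemma cinner_diff_right: "cinner x (y - z) = cinner x y - cinner x (z::'a::chilbert_space)"
  using cinner_add_right[of x y "-z"] by (simp add: cinner_minus_right)

lemma cinner_ext_right:
  assumes "\<And>x. cinner x y = cinner x (z::'a::chilbert_space)"
  shows "y = z"
proof -
  have "cinner (y - z) (y - z) = 0"
    using assms[of "y - z"] by (simp add: cinner_diff_right)
  then show ?thesis by (simp add: cinner_self)
qed

lemma norm_sq_add:
  "(norm (x + y))\<^sup>2 = (norm x)\<^sup>2 + 2 * Re (cinner x y) + (norm (y::'a::chilbert_space))\<^sup>2"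
proof -
  have "Re (cinner (x + y) (x + y)) = Re (cinner x x) + Re (cinner x y) + Re (cinner y x) + Re (cinner y y)"
    by (simp add: cinner_add_left cinner_add_right)
  moreover have "Re (cinner y x) = Re (cinner x y)"
    by (subst cinner_commute) simp
  ultimately show ?thesis by (simp add: cinner_self)
qed

lemma linear_coeff_zero:
  fixes a b :: real
  assumes "\<And>t. 0 \<le> t * a + t\<^sup>2 * b"
  shows "a = 0"
proof (rule ccontr)
  assume a: "a \<noteq> 0"
  define c where "c = 1 + \<bar>b\<bar>"
  have c: "c > 0" "b < c" by (auto simp: c_def)
  have "0 \<le> (- a / c) * a + (- a / c)\<^sup>2 * b" by (rule assms)
  also have "\<dots> = (a / c)\<^sup>2 * (b - c)"
    using c by (simp add: field_simps power2_eq_square)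
  also have "\<dots> < 0"
    using a c by (intro mult_pos_neg) auto
  finally show False by simp
qed

lemma cinner_norm_bound: "cmod (cinner x y) \<le> norm x * norm (y::'a::chilbert_space)"
proof (cases "y = 0")
  case True
  then show ?thesis using cinner_scaleR_right[of x 0 y] by simp
next
  case False
  define c where "c = cinner x y / of_real ((norm y)\<^sup>2)"
  have ny: "norm y > 0" using False by simp
  have "0 \<le> (norm (x + - (c *\<^sub>C y)))\<^sup>2" by simp
  also have "\<dots> = (norm x)\<^sup>2 - 2 * Re (cnj c * cinner x y) + (norm (c *\<^sub>C y))\<^sup>2"
    by (simp only: norm_sq_add cinner_minus_right cinner_scaleC_right norm_minus_cancel) simp
  also have "(norm (c *\<^sub>C y))\<^sup>2 = (cmod c)\<^sup>2 * (norm y)\<^sup>2"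
  proof -
    have "complex_of_real ((norm (c *\<^sub>C y))\<^sup>2) = c * cnj c * of_real ((norm y)\<^sup>2)"
      unfolding cinner_self[symmetric] by (simp add: cinner_scaleC_left cinner_scaleC_right)
    also have "\<dots> = of_real ((cmod c)\<^sup>2 * (norm y)\<^sup>2)"
      by (simp add: complex_norm_square[symmetric] del: of_real_power)
    finally show ?thesis using of_real_eq_iff by blast
  qed
  also have "Re (cnj c * cinner x y) = (cmod c)\<^sup>2 * (norm y)\<^sup>2"
  proof -
    have "cinner x y = c * of_real ((norm y)\<^sup>2)"
      using ny by (simp add: c_def)
    then have "cnj c * cinner x y = (c * cnj c) * of_real ((norm y)\<^sup>2)" by simp
    also have "\<dots> = of_real ((cmod c)\<^sup>2 * (norm y)\<^sup>2)"
      by (simp add: complex_norm_square[symmetric] del: of_real_power)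
    finally show ?thesis by (metis Re_complex_of_real)
  qed
  finally have *: "(cmod c)\<^sup>2 * (norm y)\<^sup>2 \<le> (norm x)\<^sup>2" by linarith
  then have "(cmod c * norm y)\<^sup>2 \<le> (norm x)\<^sup>2" by (simp add: power_mult_distrib)
  then have "cmod c * norm y \<le> norm x" using power2_le_imp_le by force
  moreover have "cmod c = cmod (cinner x y) / (norm y)\<^sup>2"
    by (simp add: c_def norm_divide norm_power)
  ultimately show ?thesis using ny by (simp add: field_simps power2_eq_square)
qed

lemma norm_scaleC: "norm (c *\<^sub>C x) = cmod c * norm (x::'a::chilbert_space)"
proof -
  have "complex_of_real ((norm (c *\<^sub>C x))\<^sup>2) = c * cnj c * of_real ((norm x)\<^sup>2)"
    unfolding cinner_self[symmetric] by (simp add: cinner_scaleC_left cinner_scaleC_right)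
  also have "\<dots> = of_real ((cmod c * norm x)\<^sup>2)"
    by (simp add: complex_norm_square[symmetric] power_mult_distrib del: of_real_power)
  finally have "(norm (c *\<^sub>C x))\<^sup>2 = (cmod c * norm x)\<^sup>2" using of_real_eq_iff by blast
  then show ?thesis by simp
qed

lemma riesz:
  fixes f :: "'a::chilbert_space \<Rightarrow> complex"
  assumes bl: "bounded_linear f" and cl: "\<And>c x. f (c *\<^sub>C x) = c * f x"
  shows "\<exists>z. \<forall>x. f x = cinner x z"
proof -
  interpret f: bounded_linear f by (rule bl)
  define J where "J x = (norm x)\<^sup>2 - 2 * Re (f x)" for x
  obtain K where K: "\<And>x. norm (f x) \<le> norm x * K" using f.bounded by blast
  have J_lower: "- K\<^sup>2 \<le> J x" for x
  proof -
    have "Re (f x) \<le> norm x * K" using complex_Re_le_cmod[of "f x"] K[of x] by linarith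
    moreover have "0 \<le> (norm x - K)\<^sup>2" by simp
    ultimately show ?thesis by (simp add: J_def power2_diff)
  qed
  define d where "d = Inf (range J)"
  have bdd: "bdd_below (range J)" using J_lower by (auto intro!: bdd_belowI2)
  have d_le: "d \<le> J x" for x unfolding d_def using bdd by (auto intro: cInf_lower)
  have "\<exists>x. J x < d + inverse (real (Suc n))" for n
  proof -
    have "Inf (range J) < d + inverse (real (Suc n))" by (simp add: d_def)
    then show ?thesis using cInf_lessD[of "range J"] by auto
  qed
  then obtain X where X: "\<And>n. J (X n) < d + inverse (real (Suc n))" by metis
  have par: "(norm (a - b))\<^sup>2 \<le> 2 * (J a - d) + 2 * (J b - d)" for a b
  proof -
    let ?h = "(1/2) *\<^sub>R (a + b)"
    have p: "(norm (a + b))\<^sup>2 + (norm (a - b))\<^sup>2 = 2 * (norm a)\<^sup>2 + 2 * (norm b)\<^sup>2"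
      using norm_sq_add[of a b] norm_sq_add[of a "-b"] by (simp add: cinner_minus_right)
    have "J ?h = (norm (a + b))\<^sup>2 / 4 - Re (f a) - Re (f b)"
      by (simp add: J_def f.scaleR f.add power_divide add_divide_distrib)
    with p d_le[of ?h] show ?thesis by (simp add: J_def)
  qed
  have "Cauchy X"
  proof (rule metric_CauchyI)
    fix e :: real assume e: "0 < e"
    then have "0 < e\<^sup>2 / 4" by simp
    then obtain N where N: "inverse (real (Suc N)) < e\<^sup>2 / 4" using reals_Archimedean by blast
    have *: "J (X k) - d < e\<^sup>2 / 4" if "k \<ge> N" for k
    proof -
      have "inverse (real (Suc k)) \<le> inverse (real (Suc N))"
        using that by (intro le_imp_inverse_le) auto
      with X[of k] N show ?thesis by linarith
    qed
    have "dist (X k) (X l) < e" if "k \<ge> N" "l \<ge> N" for k l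
    proof -
      have "(norm (X k - X l))\<^sup>2 < e\<^sup>2"
      proof -
        have "2 * (J (X k) - d) + 2 * (J (X l) - d) < 2 * (e\<^sup>2 / 4) + 2 * (e\<^sup>2 / 4)"
          using *[OF that(1)] *[OF that(2)] by (intro add_strict_mono mult_strict_left_mono) auto
        also have "\<dots> = e\<^sup>2" by simp
        finally show ?thesis using par[of "X k" "X l"] by (rule le_less_trans[rotated])
      qed
      then show ?thesis using e by (auto simp: dist_norm intro: power2_less_imp_less)
    qed
    then show "\<exists>M. \<forall>m\<ge>M. \<forall>n\<ge>M. dist (X m) (X n) < e" by blast
  qed
  then obtain z where z: "X \<longlonglongrightarrow> z" using Cauchy_convergent convergent_def by blast
  have "(\<lambda>n. J (X n)) \<longlonglongrightarrow> J z"
    unfolding J_def by (intro tendsto_intros f.tendsto z)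
  moreover have "(\<lambda>n. d + inverse (real (Suc n))) \<longlonglongrightarrow> d + 0"
    by (intro tendsto_intros LIMSEQ_inverse_real_of_nat)
  ultimately have "J z \<le> d + 0"
    using X by (intro LIMSEQ_le) (auto intro: less_imp_le)
  then have min: "J z \<le> J x" for x using d_le[of x] by simp
  have re: "Re (f x) = Re (cinner x z)" for x
  proof -
    have "0 \<le> t * (2 * Re (cinner z x) - 2 * Re (f x)) + t\<^sup>2 * (norm x)\<^sup>2" for t
    proof -
      have "J (z + t *\<^sub>R x) = J z + t * (2 * Re (cinner z x) - 2 * Re (f x)) + t\<^sup>2 * (norm x)\<^sup>2"
        by (simp add: J_def norm_sq_add cinner_scaleR_right f.add f.scaleR
            power_mult_distrib algebra_simps)
      with min[of "z + t *\<^sub>R x"] show ?thesis by linarith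
    qed
    then have "2 * Re (cinner z x) - 2 * Re (f x) = 0" by (rule linear_coeff_zero)
    moreover have "Re (cinner z x) = Re (cinner x z)" by (subst cinner_commute) simp
    ultimately show ?thesis by simp
  qed
  have "f x = cinner x z" for x
  proof (rule complex_eqI)
    show "Re (f x) = Re (cinner x z)" by (rule re)
    show "Im (f x) = Im (cinner x z)"
      using re[of "\<i> *\<^sub>C x"] by (simp add: cl cinner_scaleC_left)
  qed
  then show ?thesis by blast
qed


section \<open>The algebra of bounded linear operators\<close>

text \<open>The type of bounded complex-linear operators on \<open>'a\<close>; multiplication is composition.\<close>

typedef (overloaded) 'a bop =
  "{f :: 'a::chilbert_space \<Rightarrow> 'a. bounded_linear f \<and> (\<forall>c x. f (c *\<^sub>C x) = c *\<^sub>C f x)}"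
  morphisms bop_apply Bop
proof
  show "(\<lambda>x. x) \<in> {f. bounded_linear f \<and> (\<forall>c x. f (c *\<^sub>C x) = c *\<^sub>C f x)}"
    by (simp add: bounded_linear_ident)
qed

setup_lifting type_definition_bop

lemma scaleC_minus_right: "c *\<^sub>C (- x) = - (c *\<^sub>C (x::'a::chilbert_space))"
proof -
  have "c *\<^sub>C (- x) = c *\<^sub>C (complex_of_real (-1) *\<^sub>C x)"
    unfolding scaleC_of_real by simp
  also have "\<dots> = complex_of_real (-1) *\<^sub>C (c *\<^sub>C x)"
    by (simp only: scaleC_scaleC mult.commute)
  finally show ?thesis unfolding scaleC_of_real by simp
qed

lemma scaleC_zero_right: "c *\<^sub>C 0 = (0::'a::chilbert_space)"
  using scaleC_add_right[of c 0 0] by simp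

lemma scaleC_scaleR_commute: "c *\<^sub>C (r *\<^sub>R x) = r *\<^sub>R (c *\<^sub>C (x::'a::chilbert_space))"
  by (simp only: scaleC_of_real[symmetric] scaleC_scaleC mult.commute)

instantiation bop :: (chilbert_space) "{real_algebra, monoid_mult}"
begin

lift_definition zero_bop :: "'a bop" is "\<lambda>x. 0"
  by (simp add: scaleC_zero_right)
lift_definition one_bop :: "'a bop" is "\<lambda>x. x"
  by (simp add: bounded_linear_ident)
lift_definition plus_bop :: "'a bop \<Rightarrow> 'a bop \<Rightarrow> 'a bop" is "\<lambda>f g x. f x + g x"
  by (simp add: bounded_linear_add scaleC_add_right)
lift_definition uminus_bop :: "'a bop \<Rightarrow> 'a bop" is "\<lambda>f x. - f x"
  by (simp add: bounded_linear_minus scaleC_minus_right)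
lift_definition minus_bop :: "'a bop \<Rightarrow> 'a bop \<Rightarrow> 'a bop" is "\<lambda>f g x. f x - g x"
  unfolding diff_conv_add_uminus
  by (simp add: bounded_linear_add bounded_linear_minus scaleC_add_right scaleC_minus_right
      del: add_uminus_conv_diff)
lift_definition times_bop :: "'a bop \<Rightarrow> 'a bop \<Rightarrow> 'a bop" is "\<lambda>f g x. f (g x)"
  by (auto intro: bounded_linear_compose)
lift_definition scaleR_bop :: "real \<Rightarrow> 'a bop \<Rightarrow> 'a bop" is "\<lambda>r f x. r *\<^sub>R f x"
  by (auto intro: bounded_linear_const_scaleR simp: scaleC_scaleR_commute)

instance
proof
  fix a b c :: "'a bop" and r s :: real
  show "a + b + c = a + (b + c)" by transfer (simp add: add.assoc)
  show "a + b = b + a" by transfer (simp add: add.commute)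
  show "0 + a = a" by transfer simp
  show "- a + a = 0" by transfer simp
  show "a - b = a + - b" by transfer simp
  show "a * b * c = a * (b * c)" by transfer simp
  show "(a + b) * c = a * c + b * c" by transfer simp
  show "a * (b + c) = a * b + a * c"
    by transfer (auto simp: linear_add bounded_linear.linear)
  show "1 * a = a" by transfer simp
  show "a * 1 = a" by transfer simp
  show "r *\<^sub>R (a + b) = r *\<^sub>R a + r *\<^sub>R b" by transfer (simp add: scaleR_add_right)
  show "(r + s) *\<^sub>R a = r *\<^sub>R a + s *\<^sub>R a" by transfer (simp add: scaleR_add_left)
  show "r *\<^sub>R s *\<^sub>R a = (r * s) *\<^sub>R a" by transfer simp
  show "1 *\<^sub>R a = a" by transfer simp
  show "r *\<^sub>R a * b = r *\<^sub>R (a * b)" by transfer simp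
  show "a * r *\<^sub>R b = r *\<^sub>R (a * b)"
    by transfer (auto simp: linear_scale bounded_linear.linear)
qed

end

definition adj :: "'a::chilbert_space bop \<Rightarrow> 'a bop"
  where "adj T = (THE S. \<forall>x y. cinner (bop_apply T x) y = cinner x (bop_apply S y))"

lemma adj_ex1:
  fixes T :: "'a::chilbert_space bop"
  shows "\<exists>!S. \<forall>x y. cinner (bop_apply T x) y = cinner x (bop_apply S y)"
proof (rule ex_ex1I)
  interpret T: bounded_linear "bop_apply T" using bop_apply[of T] by simp
  have Tc: "bop_apply T (c *\<^sub>C x) = c *\<^sub>C bop_apply T x" for c x using bop_apply[of T] by simp
  obtain K where K: "\<And>x. norm (bop_apply T x) \<le> norm x * K" "K \<ge> 0"
    using T.nonneg_bounded by blast
  have "\<exists>z. \<forall>x. cinner (bop_apply T x) y = cinner x z" for y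
  proof (rule riesz)
    show "bounded_linear (\<lambda>x. cinner (bop_apply T x) y)"
    proof (rule bounded_linear_intro)
      fix x x' and r :: real
      show "cinner (bop_apply T (x + x')) y = cinner (bop_apply T x) y + cinner (bop_apply T x') y"
        by (simp add: T.add cinner_add_left)
      show "cinner (bop_apply T (r *\<^sub>R x)) y = r *\<^sub>R cinner (bop_apply T x) y"
        by (simp add: T.scaleR cinner_scaleR_left scaleR_conv_of_real)
      have "norm (cinner (bop_apply T x) y) \<le> norm (bop_apply T x) * norm y"
        by (rule cinner_norm_bound)
      also have "\<dots> \<le> (norm x * K) * norm y" using K(1) by (intro mult_right_mono) auto
      finally show "norm (cinner (bop_apply T x) y) \<le> norm x * (K * norm y)"
        by (simp add: mult.assoc)
    qed
    show "cinner (bop_apply T (c *\<^sub>C x)) y = c * cinner (bop_apply T x) y" for c x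
      by (simp add: Tc cinner_scaleC_left)
  qed
  then obtain S where S: "\<And>x y. cinner (bop_apply T x) y = cinner x (S y)" by metis
  have Sc: "S (c *\<^sub>C y) = c *\<^sub>C S y" for c y
    by (rule cinner_ext_right) (simp add: cinner_scaleC_right flip: S)
  have "bounded_linear S"
  proof (rule bounded_linear_intro)
    show "S (y + y') = S y + S y'" for y y'
      by (rule cinner_ext_right) (simp add: cinner_add_right flip: S)
    show "S (r *\<^sub>R y) = r *\<^sub>R S y" for r y
      by (rule cinner_ext_right) (simp add: cinner_scaleR_right flip: S)
    show "norm (S y) \<le> norm y * K" for y
    proof (cases "S y = 0")
      case False
      have "(norm (S y))\<^sup>2 = cmod (cinner (S y) (S y))"
        by (simp only: cinner_self norm_of_real abs_power2)
      also have "\<dots> = cmod (cinner (bop_apply T (S y)) y)" by (simp add: S)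
      also have "\<dots> \<le> norm (bop_apply T (S y)) * norm y" by (rule cinner_norm_bound)
      also have "\<dots> \<le> (norm (S y) * K) * norm y" using K(1) by (intro mult_right_mono) auto
      finally show ?thesis using False by (simp add: power2_eq_square mult_ac)
    qed (use K in simp)
  qed
  with Sc have "bop_apply (Bop S) = S" by (simp add: Bop_inverse)
  then show "\<exists>S. \<forall>x y. cinner (bop_apply T x) y = cinner x (bop_apply S y)"
    using S by metis
next
  fix S S' :: "'a bop"
  assume 1: "\<forall>x y. cinner (bop_apply T x) y = cinner x (bop_apply S y)"
    and 2: "\<forall>x y. cinner (bop_apply T x) y = cinner x (bop_apply S' y)"
  have "bop_apply S y = bop_apply S' y" for y
    using 1 2 by (intro cinner_ext_right) metis
  then show "S = S'" by (simp add: bop_apply_inject[symmetric] fun_eq_iff)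
qed

lemma cinner_adj: "cinner (bop_apply T x) y = cinner x (bop_apply (adj T) y)"
  using theI'[OF adj_ex1[of T]] unfolding adj_def by blast


section \<open>Left invertibility, selfadjointness and Drazin inverses\<close>

definition commutator :: "'a::chilbert_space bop \<Rightarrow> 'a bop \<Rightarrow> 'a bop"
  where "commutator S T = S * T - T * S"

definition triangle :: "nat \<Rightarrow> 'a::chilbert_space bop \<Rightarrow> 'a bop \<Rightarrow> 'a bop \<Rightarrow> 'a bop"
  where "triangle m S T Z =
    (\<Sum>j=0..m. ((-1) ^ j * real (m choose j)) *\<^sub>R (S ^ (m - j) * Z * T ^ (m - j)))"

definition delta :: "nat \<Rightarrow> 'a::chilbert_space bop \<Rightarrow> 'a bop \<Rightarrow> 'a bop \<Rightarrow> 'a bop"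
  where "delta m S T Z =
    (\<Sum>j=0..m. ((-1) ^ j * real (m choose j)) *\<^sub>R (S ^ (m - j) * Z * T ^ j))"

definition left_invertible ::
    "'a::chilbert_space bop \<Rightarrow> nat \<Rightarrow> 'a bop \<Rightarrow> 'a bop \<Rightarrow> bool"
  where "left_invertible Z m S T \<longleftrightarrow> triangle m S T Z = 0"

definition selfadjoint :: "'a::chilbert_space bop \<Rightarrow> nat \<Rightarrow> 'a bop \<Rightarrow> bool"
  where "selfadjoint Z m T \<longleftrightarrow> delta m (adj T) T Z = 0"

definition drazin_inverse :: "'a::chilbert_space bop \<Rightarrow> 'a bop \<Rightarrow> bool"
  where "drazin_inverse A D \<longleftrightarrow>
    D * A = A * D \<and> D ^ 2 * A = D \<and> (\<exists>p\<ge>1. A ^ (p + 1) * D = A ^ p)"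

end

theory Submission
  imports Defs
begin

text \<open>
  Both \<^const>\<open>delta\<close> and \<^const>\<open>triangle\<close> are powers of a single operator on the algebra of
  bounded operators: the binomial theorem turns them into the \<open>m\<close>-th iterates of
  \<open>Z \<mapsto> S Z - Z T\<close> and of \<open>Z \<mapsto> S Z T - Z\<close>, since left and right multiplications commute.

  The first half of the argument converts left invertibility into selfadjointness. Write \<open>D\<close> for
  the adjoint of \<open>A\<^sub>d\<close>, \<open>S\<close> for the adjoint of \<open>A\<close>, and \<open>P = S D\<close>, an idempotent with \<open>P D = D\<close>.
  Left invertibility expresses \<open>X\<close> as a combination of terms that begin with \<open>D\<close>, so \<open>P X = X\<close>.
  Where \<open>P\<close> acts as the identity, multiplying \<open>D Z A - Z\<close> on the left by \<open>S\<close> gives \<open>Z A - S Z\<close>.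
  Hence if the \<open>m\<close>-th iterate of the first map kills \<open>X\<close>, so does the \<open>m\<close>-th iterate of the second
  (lemma \<open>gen_derivation_power_eq_0\<close>). So \<open>A\<close> is \<open>(X,m)\<close>-selfadjoint, and in the same way \<open>B\<close> is
  \<open>(Y,n)\<close>-selfadjoint.

  The second half is the fact that a sum of commuting nilpotents of orders \<open>m\<close> and \<open>n\<close> is nilpotent
  of order \<open>m + n - 1\<close>, in a version that concerns a single vector
  (lemma \<open>funpow_combination_eq_0\<close>). Let \<open>f\<close> and \<open>g\<close> be the generalized derivations belonging to
  \<open>A\<close> and \<open>B\<close>; they commute because \<open>A\<close> and \<open>B\<close> do. As \<open>X Y = Y X\<close> and left multiplication by
  \<open>Y\<close> commutes with \<open>f\<close>, and left multiplication by \<open>X\<close> with \<open>g\<close>, the vector \<open>X Y\<close> is killed by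
  the \<open>m\<close>-th iterate of \<open>f\<close> and by the \<open>n\<close>-th iterate of \<open>g\<close>. The generalized derivation of
  \<open>A + B\<close> is \<open>f + g\<close>, and that of \<open>A B\<close> is a combination of \<open>f\<close> and \<open>g\<close> with coefficients that
  commute with both.
\<close>

section \<open>Iterates of commuting maps\<close>

lemma funpow_commute_apply:
  assumes "\<And>x. f (u x) = u (f x)"
  shows "(f ^^ n) (u x) = u ((f ^^ n) x)"
  by (induction n) (simp_all add: assms)

lemma binomial_alternating_sum_Suc:
  fixes F :: "nat \<Rightarrow> nat \<Rightarrow> 'a::real_vector"
  shows "(\<Sum>j\<le>Suc m. ((-1) ^ j * real (Suc m choose j)) *\<^sub>R F (Suc m - j) j) =
    (\<Sum>j\<le>m. ((-1) ^ j * real (m choose j)) *\<^sub>R F (Suc (m - j)) j) -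
    (\<Sum>j\<le>m. ((-1) ^ j * real (m choose j)) *\<^sub>R F (m - j) (Suc j))"
proof -
  have "(\<Sum>j\<le>m. ((-1) ^ j * real (m choose j)) *\<^sub>R F (Suc (m - j)) j) =
      (\<Sum>j\<le>m. ((-1) ^ j * real (m choose j)) *\<^sub>R F (Suc m - j) j)"
    by (intro sum.cong) (auto simp: Suc_diff_le)
  \<comment> \<open>The summand added at \<open>j = Suc m\<close> vanishes with its binomial coefficient.\<close>
  also have "\<dots> = (\<Sum>j\<le>Suc m. ((-1) ^ j * real (m choose j)) *\<^sub>R F (Suc m - j) j)"
    by simp
  also have "\<dots> = F (Suc m) 0 +
      (\<Sum>j\<le>m. ((-1) ^ Suc j * real (m choose Suc j)) *\<^sub>R F (m - j) (Suc j))"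
    unfolding sum.atMost_Suc_shift by simp
  finally show ?thesis
    unfolding sum.atMost_Suc_shift
    by (simp add: scaleR_add_left scaleR_diff_left sum.distrib sum_subtractf sum_negf distrib_left
        del: sum.atMost_Suc)
qed

text \<open>The binomial theorem for commuting linear maps: one more application of \<open>p - q\<close> raises either
  exponent by one, and Pascal's rule recombines the two sums.\<close>

lemma funpow_diff_binomial:
  fixes p q :: "'a::real_vector \<Rightarrow> 'a"
  assumes p: "linear p" and q: "linear q" and pq: "\<And>x. p (q x) = q (p x)"
  shows "((\<lambda>x. p x - q x) ^^ m) z =
    (\<Sum>j=0..m. ((-1) ^ j * real (m choose j)) *\<^sub>R (p ^^ (m - j)) ((q ^^ j) z))"
  unfolding atLeast0AtMost
proof (induction m)
  case 0
  show ?case by simp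
next
  case (Suc m)
  have "q ((p ^^ i) x) = (p ^^ i) (q x)" for i x
    by (rule funpow_commute_apply[symmetric]) (rule pq)
  then show ?case
    by (subst binomial_alternating_sum_Suc[where F = "\<lambda>i j. (p ^^ i) ((q ^^ j) z)"])
      (simp add: Suc.IH linear_sum[OF p] linear_sum[OF q] linear_scale[OF p] linear_scale[OF q]
        del: sum.atMost_Suc)
qed

text \<open>If \<open>f\<close> were nilpotent of order \<open>m\<close> and \<open>g\<close> of order \<open>n\<close>, every monomial of degree
  \<open>m + n - 1\<close> in \<open>f\<close> and \<open>g\<close> would vanish. The induction avoids expanding the power: one application
  of \<open>h\<close> splits \<open>z\<close> into \<open>u (f z)\<close>, for which the exponent \<open>m\<close> drops by one, and \<open>v (g z)\<close>, for
  which \<open>n\<close> does.\<close>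

lemma funpow_combination_eq_0:
  fixes f g u v h :: "'a::ab_group_add \<Rightarrow> 'a"
  assumes h: "\<And>x. h x = u (f x) + v (g x)"
    and add: "\<And>x y. h (x + y) = h x + h y"
    and zero: "f 0 = 0" "g 0 = 0" "u 0 = 0" "v 0 = 0"
    and fg: "\<And>x. f (g x) = g (f x)"
    and fu: "\<And>x. f (u x) = u (f x)" and gu: "\<And>x. g (u x) = u (g x)"
    and fv: "\<And>x. f (v x) = v (f x)" and gv: "\<And>x. g (v x) = v (g x)"
    and "m + n \<le> Suc k" and "(f ^^ m) z = 0" and "(g ^^ n) z = 0"
  shows "(h ^^ k) z = 0"
  using assms(12-14)
proof (induction k arbitrary: m n z)
  case 0
  then have "m = 0 \<or> n = 0" by auto
  with 0 show ?case by auto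
next
  case (Suc k)
  have h0: "h 0 = 0" by (simp add: h zero)
  have hk0: "(h ^^ k) 0 = 0" for k by (induction k) (simp_all add: h0)
  have hk_add: "(h ^^ k) (x + y) = (h ^^ k) x + (h ^^ k) y" for k x y
    by (induction k) (simp_all add: add)
  show ?case
  proof (cases "m = 0 \<or> n = 0")
    case True
    with Suc.prems have "z = 0" by auto
    then show ?thesis by (simp add: hk0 del: funpow.simps)
  next
    case False
    then obtain a b where m: "m = Suc a" and n: "n = Suc b"
      by (metis not0_implies_Suc)
    have left: "(h ^^ k) (u (f z)) = 0"
    proof (rule Suc.IH[of a n])
      show "a + n \<le> Suc k" using Suc.prems m by simp
      show "(f ^^ a) (u (f z)) = 0"
        using Suc.prems m
        by (simp add: funpow_commute_apply[of f u, OF fu] zero funpow_swap1)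
      have "(g ^^ n) (u (f z)) = u (f ((g ^^ n) z))"
        by (simp add: funpow_commute_apply[of g u, OF gu] funpow_commute_apply[of g f, OF fg[symmetric]])
      then show "(g ^^ n) (u (f z)) = 0" using Suc.prems by (simp add: zero)
    qed
    have right: "(h ^^ k) (v (g z)) = 0"
    proof (rule Suc.IH[of m b])
      show "m + b \<le> Suc k" using Suc.prems n by simp
      show "(g ^^ b) (v (g z)) = 0"
        using Suc.prems n
        by (simp add: funpow_commute_apply[of g v, OF gv] zero funpow_swap1)
      have "(f ^^ m) (v (g z)) = v (g ((f ^^ m) z))"
        by (simp add: funpow_commute_apply[of f v, OF fv] funpow_commute_apply[of f g, OF fg])
      then show "(f ^^ m) (v (g z)) = 0" using Suc.prems by (simp add: zero)
    qed
    have "(h ^^ Suc k) z = (h ^^ k) (h z)" by (simp add: funpow_swap1)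
    then show ?thesis by (simp add: h[of z] hk_add left right)
  qed
qed

section \<open>Generalized derivations and left invertibility\<close>

definition gen_derivation :: "'a::ring \<Rightarrow> 'a \<Rightarrow> 'a \<Rightarrow> 'a"
  where "gen_derivation S T Z = S * Z - Z * T"

definition inversion_defect :: "'a::ring \<Rightarrow> 'a \<Rightarrow> 'a \<Rightarrow> 'a"
  where "inversion_defect S T Z = S * Z * T - Z"

lemma funpow_mult_left: "((\<lambda>Z. S * Z) ^^ j) Z = S ^ j * (Z::'a::{ring,monoid_mult})"
  by (induction j) (simp_all add: mult.assoc)

lemma funpow_mult_right: "((\<lambda>Z. Z * T) ^^ j) Z = Z * (T::'a::{ring,monoid_mult}) ^ j"
  by (induction j) (simp_all add: mult.assoc power_commutes)

lemma funpow_mult_both: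
  "((\<lambda>Z. S * Z * T) ^^ j) Z = S ^ j * Z * (T::'a::{ring,monoid_mult}) ^ j"
proof (induction j)
  case (Suc j)
  then have "((\<lambda>Z. S * Z * T) ^^ Suc j) Z = (S * S ^ j) * Z * (T ^ j * T)"
    by (simp add: mult.assoc)
  then show ?case by (simp add: power_commutes)
qed simp

lemma delta_eq_funpow: "delta m S T Z = (gen_derivation S T ^^ m) Z"
proof -
  have "gen_derivation S T = (\<lambda>Z. S * Z - Z * T)"
    by (rule ext) (rule gen_derivation_def)
  moreover have "linear (\<lambda>Z. S * Z)" "linear (\<lambda>Z. Z * T)"
    by (auto intro!: linearI simp: distrib_left distrib_right)
  ultimately show ?thesis
    by (simp add: funpow_diff_binomial funpow_mult_left funpow_mult_right delta_def mult.assoc)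
qed

lemma triangle_eq_funpow: "triangle m S T Z = (inversion_defect S T ^^ m) Z"
proof -
  have "inversion_defect S T = (\<lambda>Z. S * Z * T - Z)"
    by (rule ext) (rule inversion_defect_def)
  moreover have "linear (\<lambda>Z. S * Z * T)"
    by (auto intro!: linearI simp: distrib_left distrib_right)
  moreover have "((\<lambda>Z::'a bop. Z) ^^ j) Z = Z" for j
    by (induction j) simp_all
  ultimately show ?thesis
    by (simp add: funpow_diff_binomial linear_ident funpow_mult_both triangle_def)
qed

text \<open>Expanding the power expresses \<open>X\<close> as a combination of elements \<open>D\<^sup>i X T\<^sup>i\<close> with \<open>i \<ge> 1\<close>, and \<open>S D\<close>
  fixes each of these because it fixes \<open>D\<close>. The induction removes one
  application of the map at a time instead.\<close>

lemma inversion_defect_power_eq_0_imp_fixed: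
  fixes S D T X :: "'a::ring"
  assumes DSD: "S * D * D = D"
    and "(inversion_defect D T ^^ m) X = 0"
  shows "S * D * X = X"
  using assms(2)
proof (induction m arbitrary: X)
  case (Suc m)
  let ?E = "inversion_defect D T X"
  have "S * D * ?E = ?E"
    using Suc.prems by (intro Suc.IH) (simp add: funpow_swap1)
  moreover have "S * D * ?E = S * D * D * X * T - S * D * X"
    by (simp add: inversion_defect_def right_diff_distrib mult.assoc)
  ultimately show ?case
    by (simp add: DSD inversion_defect_def)
qed simp

text \<open>For \<open>Z\<close> fixed by \<open>S D\<close> the generalized derivation equals
  \<open>- S (D Z T - Z)\<close>; the factor \<open>S\<close> can be pulled out because \<open>S\<close> commutes with the generalized
  derivation.\<close>

lemma gen_derivation_power_eq_0:
  fixes S D T X :: "'a::ring"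
  assumes DSD: "S * D * D = D"
    and "(inversion_defect D T ^^ m) X = 0"
  shows "(gen_derivation S T ^^ m) X = 0"
  using assms(2)
proof (induction m arbitrary: X)
  case (Suc m)
  let ?E = "inversion_defect D T X"
  have "S * D * X = X"
    using inversion_defect_power_eq_0_imp_fixed[OF DSD Suc.prems] .
  then have "gen_derivation S T X = (- S) * ?E"
    by (simp add: gen_derivation_def inversion_defect_def right_diff_distrib flip: mult.assoc)
  moreover have "(gen_derivation S T ^^ m) ((- S) * ?E) = (- S) * (gen_derivation S T ^^ m) ?E"
    by (rule funpow_commute_apply)
      (simp add: gen_derivation_def right_diff_distrib mult.assoc)
  moreover have "(gen_derivation S T ^^ m) ?E = 0"
    using Suc.prems by (intro Suc.IH) (simp add: funpow_swap1)
  ultimately show ?case by (simp add: funpow_swap1)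
qed simp

section \<open>Adjoints\<close>

lemma adj_eqI:
  assumes "\<And>x y. cinner (bop_apply T x) y = cinner x (bop_apply S y)"
  shows "adj T = S"
proof -
  have "bop_apply (adj T) y = bop_apply S y" for y
    by (rule cinner_ext_right) (metis assms cinner_adj)
  then show ?thesis by (simp add: bop_apply_inject[symmetric] fun_eq_iff)
qed

lemma adj_mult: "adj (S * T) = adj T * adj S"
  by (rule adj_eqI) (simp add: times_bop.rep_eq cinner_adj)

lemma adj_add: "adj (S + T) = adj S + adj T"
  by (rule adj_eqI)
    (simp add: plus_bop.rep_eq cinner_adj cinner_add_left cinner_add_right)

lemma commutator_eq_0_iff: "commutator S T = 0 \<longleftrightarrow> S * T = T * S"
  by (simp add: commutator_def)

lemma left_invertible_adj_drazin_imp_selfadjoint: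
  assumes dr: "drazin_inverse A Ad" and inv: "left_invertible X m (adj Ad) A"
  shows "selfadjoint X m A"
proof -
  have "Ad * (Ad * A) = Ad"
    using dr unfolding drazin_inverse_def power2_eq_square mult.assoc by blast
  then have "adj A * adj Ad * adj Ad = adj Ad"
    by (simp flip: adj_mult)
  then show ?thesis
    using inv by (simp add: selfadjoint_def left_invertible_def delta_eq_funpow
        triangle_eq_funpow gen_derivation_power_eq_0)
qed

section \<open>Sums and products of commuting operators\<close>

theorem theorem2p9:
  fixes A B Ad Bd X Y :: "'h::chilbert_space bop" and m n :: nat
  assumes "infinite_dimensional TYPE('h)"
    and "drazin_inverse A Ad" and "drazin_inverse B Bd"
    and "m \<ge> 1" and "n \<ge> 1"
    and "left_invertible X m (adj Ad) A"
    and "left_invertible Y n (adj Bd) B"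
    and "commutator X Y = 0" and "commutator A B = 0"
    and "commutator (adj A) Y = 0" and "commutator (adj B) X = 0"
  shows "selfadjoint (X * Y) (m + n - 1) (A * B)
    \<and> selfadjoint (X * Y) (m + n - 1) (A + B)"
proof -
  let ?f = "gen_derivation (adj A) A" and ?g = "gen_derivation (adj B) B"
  have XY: "X * Y = Y * X" and AB: "A * B = B * A"
    and AY: "adj A * Y = Y * adj A" and BX: "adj B * X = X * adj B"
    using assms by (simp_all add: commutator_eq_0_iff)
  have AB_adj: "adj A * adj B = adj B * adj A"
    by (metis AB adj_mult)
  have AB': "A * (B * Z) = B * (A * Z)"
    and AB_adj': "adj A * (adj B * Z) = adj B * (adj A * Z)" for Z
    by (metis AB mult.assoc, metis AB_adj mult.assoc)

  have "(?f ^^ m) X = 0" "(?g ^^ n) Y = 0"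
    using left_invertible_adj_drazin_imp_selfadjoint[of A Ad X m]
      left_invertible_adj_drazin_imp_selfadjoint[of B Bd Y n] assms
    by (simp_all add: selfadjoint_def delta_eq_funpow)
  moreover have "(?f ^^ m) (Y * X) = Y * (?f ^^ m) X"
    by (rule funpow_commute_apply)
      (metis (no_types, opaque_lifting) AY gen_derivation_def mult.assoc right_diff_distrib)
  moreover have "(?g ^^ n) (X * Y) = X * (?g ^^ n) Y"
    by (rule funpow_commute_apply)
      (metis (no_types, opaque_lifting) BX gen_derivation_def mult.assoc right_diff_distrib)
  ultimately have f: "(?f ^^ m) (X * Y) = 0" and g: "(?g ^^ n) (X * Y) = 0"
    by (simp_all add: XY)

  note expand = gen_derivation_def algebra_simps AB AB' AB_adj AB_adj'
  have fg: "?f (?g Z) = ?g (?f Z)" for Z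
    by (simp add: expand)
  have mn: "m + n \<le> Suc (m + n - 1)" by simp

  \<comment> \<open>With \<open>S\<close> and \<open>R\<close> the adjoints of \<open>A\<close> and \<open>B\<close>:
    \<open>R S Z - Z A B = R (S Z - Z A) + (R Z - Z B) A\<close>.\<close>
  have "(gen_derivation (adj (A * B)) (A * B) ^^ (m + n - 1)) (X * Y) = 0"
    by (rule funpow_combination_eq_0[where f = ?f and g = ?g and u = "\<lambda>Z. adj B * Z"
          and v = "\<lambda>Z. Z * A", OF _ _ _ _ _ _ fg _ _ _ _ mn f g])
      (simp_all add: expand adj_mult)
  moreover have "(gen_derivation (adj (A + B)) (A + B) ^^ (m + n - 1)) (X * Y) = 0"
    by (rule funpow_combination_eq_0[where f = ?f and g = ?g and u = "\<lambda>Z. Z"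
          and v = "\<lambda>Z. Z", OF _ _ _ _ _ _ fg _ _ _ _ mn f g])
      (simp_all add: gen_derivation_def algebra_simps adj_add)
  ultimately show ?thesis
    by (simp add: selfadjoint_def delta_eq_funpow)
qed

end
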